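(* Let $n\ge 2$, let $(A,B)$ be a regular pair of matrices in $\mathbb{C}^{n\times n}$ with distinct generalized eigenvalues, with generalized Schur decomposition $A=UTV^H$, $B=URV^H$ ($U,V$ unitary, $T,R$ upper triangular), and let $\widetilde A=A+\Delta A=\widetilde U\widetilde T\widetilde V^H$, $\widetilde B=B+\Delta B=\widetilde U\widetilde R\widetilde V^H$ be a generalized Schur decomposition of a perturbed pair ($\widetilde U,\widetilde V$ unitary, $\widetilde T,\widetilde R$ upper triangular). Let $x=\mathrm{slvec}(U^H(\widetilde U-U))$ and $y=\mathrm{slvec}(V^H(\widetilde V-V))$ be the basic perturbation vectors and let $x_{lin},y_{lin}\in\mathbb{C}^{\nu}$, $\nu=n(n-1)/2$, be their linear approximations, defined by $$\begin{bmatrix}x_{lin}\\ y_{lin}\end{bmatrix}=L^{-1}\begin{bmatrix} f\\ g\end{bmatrix}.$$ Then for every $j=1,2,\dots,\nu$, $$|x_{lin,j}|\le \|L^{-1}_{j,:}\|_2\left\|\begin{bmatrix}\Delta A\\ \Delta B\end{bmatrix}\right\|_F,\qquad |y_{lin,j}|\le \|L^{-1}_{j+\nu,:}\|_2\left\|\begin{bmatrix}\Delta A\\ \Delta B\end{bmatrix}\right\|_F,$$ where $L^{-1}_{l,:}$ denotes the $l$th row of $L^{-1}$.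
   Context: The pair $(A,B)$ is regular if $\det(A-\lambda B)\not\equiv 0$ as a polynomial in $\lambda$; its generalized eigenvalues are the pairs $\langle t_{ii},r_{ii}\rangle$ of diagonal entries of $T,R$ (regarded projectively, i.e. $\lambda_i=t_{ii}/r_{ii}\in\mathbb{C}\cup\{\infty\}$), and they are assumed pairwise distinct. For $M=(m_{ij})\in\mathbb{C}^{n\times n}$, $\mathrm{vec}(M)$ stacks the columns of $M$, and $\mathrm{slvec}(M)\in\mathbb{C}^{\nu}$ stacks the strictly lower triangular entries column by column: for $i>j$, the entry $m_{ij}$ is in position $l=i+(j-1)n-\frac{j(j+1)}{2}$. $M_{\rm slvec}\in\mathbb{C}^{\nu\times n^2}$ is the 0-1 matrix with $\mathrm{slvec}(M)=M_{\rm slvec}\mathrm{vec}(M)$ for all $M$. $$L=\begin{bmatrix}-L_{T,X}&L_{T,Y}\\ -L_{R,X}&L_{R,Y}\end{bmatrix}\in\mathbb{C}^{2\nu\times 2\nu},$$ with $L_{T,X}=M_{\rm slvec}(T^T\otimes I_n)M_{\rm slvec}^T$, $L_{T,Y}=M_{\rm slvec}(I_n\otimes T)M_{\rm slvec}^T$, $L_{R,X}=M_{\rm slvec}(R^T\otimes I_n)M_{\rm slvec}^T$, $L_{R,Y}=M_{\rm slvec}(I_n\otimes R)M_{\rm slvec}^T$. $L$ is nonsingular under the stated assumptions. $f=\mathrm{slvec}(-\widetilde U^H\Delta A\,\widetilde V)$ and $g=\mathrm{slvec}(-\widetilde U^H\Delta B\,\widetilde V)$. The vectors $x,y$ satisfy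 $L\begin{bmatrix}x\\ y\end{bmatrix}=\begin{bmatrix}f\\ g\end{bmatrix}+\begin{bmatrix}\Delta^x\\ \Delta^y\end{bmatrix}$ with $\Delta^x,\Delta^y$ of second order in $\widetilde U-U$, $\widetilde V-V$; the linear approximation drops $\Delta^x,\Delta^y$. *)

theory Defs
  imports
    "Jordan_Normal_Form.Schur_Decomposition"
    "HOL-Analysis.L2_Norm"
begin

definition unitary_mat :: "complex mat \<Rightarrow> bool" where
  "unitary_mat U \<longleftrightarrow>
     square_mat U \<and> inverts_mat U (mat_adjoint U) \<and> inverts_mat (mat_adjoint U) U"

definition generalized_schur ::
  "nat \<Rightarrow> complex mat \<Rightarrow> complex mat \<Rightarrow> complex mat \<Rightarrow> complex mat \<Rightarrow> complex mat \<Rightarrow> complex mat \<Rightarrow> bool"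
where
  "generalized_schur n A B U V T R \<longleftrightarrow>
     U \<in> carrier_mat n n \<and> V \<in> carrier_mat n n \<and> T \<in> carrier_mat n n \<and> R \<in> carrier_mat n n \<and>
     unitary_mat U \<and> unitary_mat V \<and> upper_triangular T \<and> upper_triangular R \<and>
     A = U * T * mat_adjoint V \<and> B = U * R * mat_adjoint V"

text \<open>The determinant is taken in the polynomial ring, with \<open>[:0, 1:]\<close> as the
  indeterminate \<open>\<lambda>\<close>.\<close>

definition regular_pair :: "complex mat \<Rightarrow> complex mat \<Rightarrow> bool" where
  "regular_pair A B \<longleftrightarrow>
     det (map_mat (\<lambda>a. [:a:]) A - [:0, 1:] \<cdot>\<^sub>m map_mat (\<lambda>b. [:b:]) B) \<noteq> 0"

text \<open>An element of \<open>\<complex> \<union> {\<infinity>}\<close>, with \<^const>\<open>None\<close> for \<open>\<infinity>\<close>. The undefined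
  quotient \<open>0/0\<close> is also sent to \<^const>\<open>None\<close>; it does not occur for a regular pair, because
  \<open>det (A - \<lambda>B)\<close> is a nonzero constant times the product of all \<open>t\<^sub>i\<^sub>i - \<lambda> r\<^sub>i\<^sub>i\<close>.\<close>

definition gen_eigenvalue :: "complex mat \<Rightarrow> complex mat \<Rightarrow> nat \<Rightarrow> complex option" where
  "gen_eigenvalue T R i =
     (if R $$ (i, i) = 0 then None else Some (T $$ (i, i) / R $$ (i, i)))"

definition vectorize :: "'a mat \<Rightarrow> 'a vec" where
  "vectorize M = vec (dim_row M * dim_col M) (\<lambda>k. M $$ (k mod dim_row M, k div dim_row M))"

definition kronecker :: "'a :: times mat \<Rightarrow> 'a mat \<Rightarrow> 'a mat" where
  "kronecker A B = mat (dim_row A * dim_row B) (dim_col A * dim_col B)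
     (\<lambda>(i, j). A $$ (i div dim_row B, j div dim_col B) * B $$ (i mod dim_row B, j mod dim_col B))"

text \<open>The strictly lower triangular positions of an \<open>n \<times> n\<close> matrix, column by column.\<close>

definition sl_indices :: "nat \<Rightarrow> (nat \<times> nat) list" where
  "sl_indices n = concat (map (\<lambda>j. map (\<lambda>i. (i, j)) [Suc j..<n]) [0..<n])"

definition slvec :: "'a mat \<Rightarrow> 'a vec" where
  "slvec M = vec_of_list (map (\<lambda>p. M $$ p) (sl_indices (dim_row M)))"

definition M_slvec :: "nat \<Rightarrow> 'a :: zero_neq_one mat" where
  "M_slvec n = mat (n * (n - 1) div 2) (n * n)
     (\<lambda>(l, k). if sl_indices n ! l = (k mod n, k div n) then 1 else 0)"

definition L_mat :: "nat \<Rightarrow> complex mat \<Rightarrow> complex mat \<Rightarrow> complex mat" where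
  "L_mat n T R =
    (let M = M_slvec n;
         L_TX = M * kronecker (transpose_mat T) (1\<^sub>m n) * transpose_mat M;
         L_TY = M * kronecker (1\<^sub>m n) T * transpose_mat M;
         L_RX = M * kronecker (transpose_mat R) (1\<^sub>m n) * transpose_mat M;
         L_RY = M * kronecker (1\<^sub>m n) R * transpose_mat M
     in four_block_mat (- L_TX) L_TY (- L_RX) L_RY)"

definition norm2_vec :: "complex vec \<Rightarrow> real" where
  "norm2_vec v = L2_set (\<lambda>i. cmod (v $ i)) {..<dim_vec v}"

definition frobenius_norm :: "complex mat \<Rightarrow> real" where
  "frobenius_norm A = L2_set (\<lambda>p. cmod (A $$ p)) ({..<dim_row A} \<times> {..<dim_col A})"

text \<open>The facts below confirm that \<^const>\<open>slvec\<close> and \<^const>\<open>M_slvec\<close> have the intended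
  layout. With indices starting at 0, the entry \<open>(i, j)\<close> is in position
  \<open>i + j n - (j + 1) (j + 2) / 2\<close>.\<close>

lemma sl_indices_prefix:
  assumes "m \<le> n"
  defines "P \<equiv> \<lambda>m. concat (map (\<lambda>j. map (\<lambda>i. (i, j)) [Suc j..<n]) [0..<m])"
  shows "2 * length (P m) + m * (m + 1) = 2 * m * n \<and>
    (\<forall>i j l. j < m \<and> j < i \<and> i < n \<and> 2 * l + (j + 1) * (j + 2) = 2 * (i + j * n) \<longrightarrow>
       l < length (P m) \<and> P m ! l = (i, j))"
  using assms(1)
proof (induction m)
  case 0
  show ?case by (simp add: P_def)
next
  case (Suc m)
  have step: "P (Suc m) = P m @ map (\<lambda>i. (i, m)) [Suc m..<n]"
    by (simp add: P_def)
  have IH1: "2 * length (P m) + m * (m + 1) = 2 * m * n"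
    and IH2: "\<And>i j l. j < m \<Longrightarrow> j < i \<Longrightarrow> i < n \<Longrightarrow> 2 * l + (j + 1) * (j + 2) = 2 * (i + j * n)
       \<Longrightarrow> l < length (P m) \<and> P m ! l = (i, j)"
    using Suc.IH Suc.prems by auto
  obtain d where d: "n = Suc m + d"
    using Suc.prems le_Suc_ex by blast
  have len: "2 * length (P (Suc m)) + Suc m * (Suc m + 1) = 2 * Suc m * n"
    using IH1 by (simp add: step d algebra_simps)
  have "l < length (P (Suc m)) \<and> P (Suc m) ! l = (i, j)"
    if *: "j < Suc m" "j < i" "i < n" "2 * l + (j + 1) * (j + 2) = 2 * (i + j * n)" for i j l
  proof (cases "j = m")
    case True
    obtain e where e: "i = Suc m + e"
      using * True by (metis Suc_leI le_Suc_ex)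
    have "2 * l = 2 * (length (P m) + e)"
      using IH1 *(4) by (simp add: True e algebra_simps)
    hence "l = length (P m) + e" by simp
    moreover have "e < d" using * e d by simp
    ultimately show ?thesis using e True by (simp add: step d nth_append del: upt_Suc)
  next
    case False
    hence "l < length (P m) \<and> P m ! l = (i, j)" using IH2[OF _ *(2-4)] *(1) by linarith
    thus ?thesis by (simp add: step nth_append)
  qed
  with len show ?case by blast
qed

lemma length_sl_indices: "length (sl_indices n) = n * (n - 1) div 2"
proof -
  have "2 * length (sl_indices n) + n * (n + 1) = 2 * n * n"
    using sl_indices_prefix[of n n] by (simp add: sl_indices_def)
  moreover have "n * (n - 1) + n * (n + 1) = 2 * n * n"
    by (cases n) (simp_all add: algebra_simps)
  ultimately show ?thesis by linarith
qed

lemma set_sl_indices: "set (sl_indices n) = {(i, j). j < i \<and> i < n}"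
  by (fastforce simp: sl_indices_def)

lemma sl_indices_nth:
  assumes "j < i" "i < n"
  defines "l \<equiv> i + j * n - (j + 1) * (j + 2) div 2"
  shows "l < n * (n - 1) div 2" and "sl_indices n ! l = (i, j)"
proof -
  obtain a where a: "i = Suc j + a" using assms(1) less_iff_Suc_add by auto
  obtain b where b: "n = Suc i + b" using assms(2) less_iff_Suc_add by auto
  have le: "(j + 1) * (j + 2) \<le> 2 * (i + j * n)"
    by (simp add: a b algebra_simps)
  have "even ((j + 1) * (j + 2))" by simp
  with le have "2 * l + (j + 1) * (j + 2) = 2 * (i + j * n)"
    unfolding l_def by (metis add_diff_cancel_left' distrib_left dvd_mult_div_cancel le_add_diff_inverse2
        mult_le_cancel1 zero_less_numeral)
  hence "l < length (sl_indices n) \<and> sl_indices n ! l = (i, j)"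
    using sl_indices_prefix[of n n] assms(1,2) unfolding sl_indices_def
    by (meson order.refl less_trans)
  thus "l < n * (n - 1) div 2" "sl_indices n ! l = (i, j)"
    by (simp_all add: length_sl_indices)
qed

lemma slvec_carrier: "M \<in> carrier_mat n n \<Longrightarrow> slvec M \<in> carrier_vec (n * (n - 1) div 2)"
  by (auto simp: slvec_def length_sl_indices intro!: carrier_vecI)

lemma slvec_index:
  assumes "M \<in> carrier_mat n n" "l < n * (n - 1) div 2"
  shows "slvec M $ l = M $$ (sl_indices n ! l)"
  using assms by (simp add: slvec_def length_sl_indices vec_of_list_index del: vec_of_list_map)

lemma slvec_entry:
  assumes "M \<in> carrier_mat n n" "j < i" "i < n"
  shows "slvec M $ (i + j * n - (j + 1) * (j + 2) div 2) = M $$ (i, j)"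
  using sl_indices_nth[OF assms(2,3)] slvec_index[OF assms(1)] by metis

lemma slvec_eq_M_slvec:
  fixes M :: "'a :: comm_ring_1 mat"
  assumes "M \<in> carrier_mat n n"
  shows "slvec M = M_slvec n *\<^sub>v vectorize M"
proof (rule eq_vecI)
  show "dim_vec (slvec M) = dim_vec (M_slvec n *\<^sub>v vectorize M)"
    using slvec_carrier[OF assms] by (simp add: M_slvec_def)
  fix l assume "l < dim_vec (M_slvec n *\<^sub>v vectorize M)"
  hence l: "l < n * (n - 1) div 2" by (simp add: M_slvec_def)
  obtain i j where ij: "sl_indices n ! l = (i, j)" by fastforce
  have "(i, j) \<in> set (sl_indices n)"
    using l ij length_sl_indices nth_mem by metis
  hence j: "j < i" "i < n" by (auto simp: set_sl_indices)
  have k: "j * n + i < n * n"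
  proof -
    have "j * n + i < Suc j * n" using j by simp
    also have "\<dots> \<le> n * n" using j by (intro mult_right_mono) auto
    finally show ?thesis .
  qed
  have uniq: "(i, j) = (k mod n, k div n) \<longleftrightarrow> k = j * n + i" for k
    using j by (auto simp: div_mult_mod_eq)
  have "(M_slvec n *\<^sub>v vectorize M) $ l =
      (\<Sum>k<n * n. (if k = j * n + i then 1 else 0) * M $$ (k mod n, k div n))"
    using assms l ij
    by (simp add: M_slvec_def vectorize_def scalar_prod_def uniq[simplified] atLeast0LessThan)
  also have "\<dots> = (\<Sum>k<n * n. if k = j * n + i then M $$ (k mod n, k div n) else 0)"
    by (intro sum.cong) auto
  also have "\<dots> = M $$ (i, j)"
    using k j by (simp add: sum.delta)
  finally show "slvec M $ l = (M_slvec n *\<^sub>v vectorize M) $ l"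
    using slvec_index[OF assms l] ij by simp
qed

lemma mat_inverse_invertible:
  fixes A :: "'a :: field mat"
  assumes A: "A \<in> carrier_mat n n" and inv: "invertible_mat A"
  shows "the (mat_inverse A) \<in> carrier_mat n n"
    and "A * the (mat_inverse A) = 1\<^sub>m n" and "the (mat_inverse A) * A = 1\<^sub>m n"
proof -
  obtain C where C: "inverts_mat A C" "inverts_mat C A"
    using inv by (auto simp: invertible_mat_def)
  have AC: "A * C = 1\<^sub>m n" using C(1) A by (simp add: inverts_mat_def)
  have CA: "C * A = 1\<^sub>m (dim_row C)" using C(2) by (simp add: inverts_mat_def)
  have "dim_col C = n" using arg_cong[OF AC, of dim_col] by simp
  moreover have "dim_row C = n" using arg_cong[OF CA, of dim_col] A by simp
  ultimately have "C \<in> carrier_mat n n" by auto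
  hence "A \<in> Units (ring_mat TYPE('a) n ())"
    using A AC CA by (auto simp: Units_def ring_mat_def)
  then obtain B where "mat_inverse A = Some B"
    using mat_inverse(1)[OF A, of "()"] by fastforce
  thus "the (mat_inverse A) \<in> carrier_mat n n"
    and "A * the (mat_inverse A) = 1\<^sub>m n" and "the (mat_inverse A) * A = 1\<^sub>m n"
    using mat_inverse(2)[OF A] by auto
qed

end

theory Submission
  imports Defs
begin

text \<open>Written for strictly lower triangular matrices \<open>X\<close> and \<open>Y\<close>, the system \<open>L z = 0\<close> says that
  \<open>T Y - X T\<close> and \<open>R Y - X R\<close> are upper triangular. In position \<open>(i, j)\<close> with \<open>i > j\<close> these
  equations involve only entries of \<open>X\<close>, \<open>Y\<close> on the same or a lower subdiagonal, so that the
  subdiagonals can be eliminated starting from the bottom left corner; each step is a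
  \<open>2 \<times> 2\<close> system with determinant \<open>t\<^sub>j\<^sub>j r\<^sub>i\<^sub>i - t\<^sub>i\<^sub>i r\<^sub>j\<^sub>j \<noteq> 0\<close>. Hence \<open>L\<close> is nonsingular.
  The bounds then follow from the Cauchy-Schwarz inequality and the unitary invariance of the
  Frobenius norm.\<close>

subsection \<open>Vectorization\<close>

text \<open>The range splits into \<open>q\<close> consecutive blocks of length \<open>p\<close>;
  \<open>k div p\<close> names the block and \<open>k mod p\<close> the offset in it. This turns
  sums over column-major positions into double sums over matrix entries.\<close>

lemma sum_lessThan_mult_div_mod:
  fixes h :: "nat \<Rightarrow> nat \<Rightarrow> 'a :: comm_monoid_add"
  shows "(\<Sum>k<q * p. h (k mod p) (k div p)) = (\<Sum>j<q. \<Sum>i<p. h i j)"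
proof -
  have "(\<Sum>k<q * p. h (k mod p) (k div p))
      = (\<Sum>j<q. \<Sum>k\<in>{j * p..<j * p + p}. h (k mod p) (k div p))"
    by (rule sum.nat_group[symmetric])
  also have "\<dots> = (\<Sum>j<q. \<Sum>i<p. h i j)"
  proof (rule sum.cong[OF refl])
    fix j
    show "(\<Sum>k\<in>{j * p..<j * p + p}. h (k mod p) (k div p)) = (\<Sum>i<p. h i j)"
      by (rule sym, rule sum.reindex_bij_witness[of _ "\<lambda>k. k - j * p" "\<lambda>i. j * p + i"]) auto
  qed
  finally show ?thesis .
qed

lemma kronecker_carrier:
  "A \<in> carrier_mat m n \<Longrightarrow> B \<in> carrier_mat p q \<Longrightarrow> kronecker A B \<in> carrier_mat (m * p) (n * q)"
  by (simp add: kronecker_def)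

lemma vectorize_carrier: "A \<in> carrier_mat m n \<Longrightarrow> vectorize A \<in> carrier_vec (m * n)"
  by (simp add: vectorize_def)

text \<open>This is the identity vec(AXB) = (B^T kron A) vec(X). Component \<open>k\<close> belongs
  to row \<open>k mod m\<close> and column \<open>k div m\<close> of the product, and the sum over
  positions of \<open>X\<close> regroups into the two nested sums of a triple product. Choosing
  \<open>A\<close> or \<open>B\<close> as the identity gives both kinds of blocks in
  \<open>L_mat\<close>.\<close>

lemma kronecker_mult_vectorize:
  fixes A B X :: "'a :: comm_semiring_1 mat"
  assumes A: "A \<in> carrier_mat m p" and X: "X \<in> carrier_mat p q" and B: "B \<in> carrier_mat q r"
  shows "kronecker (transpose_mat B) A *\<^sub>v vectorize X = vectorize (A * X * B)"
proof (rule eq_vecI)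
  show "dim_vec (kronecker (transpose_mat B) A *\<^sub>v vectorize X) = dim_vec (vectorize (A * X * B))"
    using assms by (simp add: kronecker_def vectorize_def)
  fix k assume "k < dim_vec (vectorize (A * X * B))"
  hence k: "k < r * m" using assms by (simp add: vectorize_def mult.commute)
  hence m: "0 < m" by (cases m) auto
  define i j where "i = k mod m" and "j = k div m"
  have ij: "i < m" "j < r" using k m by (simp_all add: i_def j_def less_mult_imp_div_less)
  have "(kronecker (transpose_mat B) A *\<^sub>v vectorize X) $ k
      = (\<Sum>l<q * p. A $$ (i, l mod p) * X $$ (l mod p, l div p) * B $$ (l div p, j))"
    using assms k ij
    by (auto simp: kronecker_def vectorize_def scalar_prod_def i_def j_def atLeast0LessThan
        less_mult_imp_div_less mult_ac intro!: sum.cong)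
  also have "\<dots> = (\<Sum>b<q. \<Sum>a<p. A $$ (i, a) * X $$ (a, b) * B $$ (b, j))"
    by (rule sum_lessThan_mult_div_mod[where h = "\<lambda>a b. A $$ (i, a) * X $$ (a, b) * B $$ (b, j)"])
  also have "\<dots> = (\<Sum>a<p. \<Sum>b<q. A $$ (i, a) * (X $$ (a, b) * B $$ (b, j)))"
    by (subst sum.swap) (simp only: mult.assoc)
  also have "\<dots> = (A * X * B) $$ (i, j)"
    using assms ij by (simp add: scalar_prod_def atLeast0LessThan sum_distrib_left)
  also have "\<dots> = vectorize (A * X * B) $ k"
    using assms k by (simp add: vectorize_def i_def j_def mult.commute)
  finally show "(kronecker (transpose_mat B) A *\<^sub>v vectorize X) $ k = vectorize (A * X * B) $ k" .
qed

subsection \<open>The strictly lower triangular part\<close>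

lemma distinct_sl_indices: "distinct (sl_indices n)"
proof -
  \<comment> \<open>The number \<open>m\<close> of columns is separated from \<open>n\<close>, which
    also bounds the inner lists, so that the induction can add one column at a time.\<close>
  have "distinct (concat (map (\<lambda>j. map (\<lambda>i. (i, j)) [Suc j..<n]) [0..<m]))" for m
    by (induction m) (auto simp: distinct_map inj_on_def simp del: upt_Suc simp: upt_Suc_append)
  thus ?thesis by (simp add: sl_indices_def)
qed

lemma sum_sl_indices:
  "(\<Sum>l<n * (n - 1) div 2. h (sl_indices n ! l)) = (\<Sum>p | snd p < fst p \<and> fst p < n. h p)"
proof -
  have "bij_betw ((!) (sl_indices n)) {..<n * (n - 1) div 2} {p. snd p < fst p \<and> fst p < n}"
    by (rule bij_betw_nth)
      (auto simp: distinct_sl_indices length_sl_indices set_sl_indices)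
  thus ?thesis by (rule sum.reindex_bij_betw)
qed

lemma M_slvec_carrier: "M_slvec n \<in> carrier_mat (n * (n - 1) div 2) (n * n)"
  by (simp add: M_slvec_def)

text \<open>The transposed selection matrix puts each entry of \<open>slvec X\<close> back in its
  place and fills all other places with 0, so nothing is lost when \<open>X\<close> is strictly
  lower triangular.\<close>

lemma transpose_M_slvec_mult_slvec:
  fixes X :: "'a :: comm_ring_1 mat"
  assumes X: "X \<in> carrier_mat n n" and lower: "\<forall>j<n. \<forall>i\<le>j. X $$ (i, j) = 0"
  shows "transpose_mat (M_slvec n) *\<^sub>v slvec X = vectorize X"
proof (rule eq_vecI)
  show "dim_vec (transpose_mat (M_slvec n) *\<^sub>v slvec X) = dim_vec (vectorize X)"
    using X by (simp add: M_slvec_def vectorize_def)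
  fix k assume "k < dim_vec (vectorize X)"
  hence k: "k < n * n" using X by (simp add: vectorize_def)
  let ?q = "(k mod n, k div n)"
  have n: "0 < n" using k by (cases n) auto
  have q: "k mod n < n" "k div n < n" using k n by (simp_all add: less_mult_imp_div_less)
  have fin: "finite {p :: nat \<times> nat. snd p < fst p \<and> fst p < n}"
    by (rule finite_subset[of _ "{..<n} \<times> {..<n}"]) auto
  have "(transpose_mat (M_slvec n) *\<^sub>v slvec X) $ k =
      (\<Sum>l<n * (n - 1) div 2. (if sl_indices n ! l = ?q then 1 else 0) * X $$ (sl_indices n ! l))"
    using k X slvec_carrier[OF X]
    by (auto simp: M_slvec_def scalar_prod_def atLeast0LessThan slvec_index intro!: sum.cong)
  also have "\<dots> = (\<Sum>p | snd p < fst p \<and> fst p < n. (if p = ?q then 1 else 0) * X $$ p)"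
    by (rule sum_sl_indices)
  also have "\<dots> = (\<Sum>p | snd p < fst p \<and> fst p < n. if p = ?q then X $$ p else 0)"
    by (intro sum.cong) auto
  \<comment> \<open>If \<open>?q\<close> is strictly lower, the sum picks out its term. Otherwise
    the sum is 0, and so is \<open>X $$ ?q\<close> by \<open>lower\<close>.\<close>
  also have "\<dots> = X $$ ?q"
    using q lower by (simp add: sum.delta[OF fin])
  finally show "(transpose_mat (M_slvec n) *\<^sub>v slvec X) $ k = vectorize X $ k"
    using k X by (simp add: vectorize_def)
qed

text \<open>Allows an arbitrary vector in the domain of \<open>L\<close> to be read as a pair of
  strictly lower triangular matrices.\<close>

lemma slvec_surj:
  fixes v :: "'a :: comm_ring_1 vec"
  assumes v: "v \<in> carrier_vec (n * (n - 1) div 2)"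
  obtains X where "X \<in> carrier_mat n n" "\<forall>j<n. \<forall>i\<le>j. X $$ (i, j) = 0"
    "slvec X = v"
proof
  let ?X = "mat n n (\<lambda>(i, j). if j < i then v $ (i + j * n - (j + 1) * (j + 2) div 2) else 0)"
  show X: "?X \<in> carrier_mat n n" by simp
  show "\<forall>j<n. \<forall>i\<le>j. ?X $$ (i, j) = 0"
    by simp
  show "slvec ?X = v"
  proof (rule eq_vecI)
    show "dim_vec (slvec ?X) = dim_vec v"
      using slvec_carrier[OF X] v by simp
    fix l assume "l < dim_vec v"
    hence l: "l < n * (n - 1) div 2" using v by simp
    obtain i j where ij: "sl_indices n ! l = (i, j)" by fastforce
    have "(i, j) \<in> set (sl_indices n)"
      using l ij length_sl_indices nth_mem by metis
    hence ji: "j < i" "i < n" by (auto simp: set_sl_indices)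
    \<comment> \<open>Both positions of the list hold \<open>(i, j)\<close>, and the list is
      distinct.\<close>
    have "i + j * n - (j + 1) * (j + 2) div 2 = l"
      using sl_indices_nth[OF ji] l ij distinct_sl_indices[of n]
      by (metis length_sl_indices nth_eq_iff_index_eq)
    thus "slvec ?X $ l = v $ l"
      using slvec_index[OF X l] ij ji by simp
  qed
qed

lemma slvec_zero: "slvec (0\<^sub>m n n) = (0\<^sub>v (n * (n - 1) div 2) :: 'a :: zero vec)"
proof (rule eq_vecI)
  note carr = zero_carrier_mat[where 'a = 'a, of n n]
  show "dim_vec (slvec (0\<^sub>m n n :: 'a mat)) = dim_vec (0\<^sub>v (n * (n - 1) div 2) :: 'a vec)"
    using slvec_carrier[OF carr] by simp
  fix l assume "l < dim_vec (0\<^sub>v (n * (n - 1) div 2) :: 'a vec)"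
  hence l: "l < n * (n - 1) div 2" by simp
  obtain i j where ij: "sl_indices n ! l = (i, j)" by fastforce
  have "(i, j) \<in> set (sl_indices n)"
    using l ij length_sl_indices nth_mem by metis
  hence "j < i" "i < n" by (auto simp: set_sl_indices)
  thus "slvec (0\<^sub>m n n :: 'a mat) $ l = (0\<^sub>v (n * (n - 1) div 2) :: 'a vec) $ l"
    using slvec_index[OF carr l] l ij by simp
qed

subsection \<open>Nonsingularity of \<open>L\<close>\<close>

lemma L_mat_carrier:
  assumes "T \<in> carrier_mat n n" "R \<in> carrier_mat n n"
  defines "\<nu> \<equiv> n * (n - 1) div 2"
  shows "L_mat n T R \<in> carrier_mat (\<nu> + \<nu>) (\<nu> + \<nu>)"
  by (intro carrier_matI) (simp_all add: L_mat_def Let_def M_slvec_def \<nu>_def)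

text \<open>In each block, the transpose of \<open>M_slvec\<close> restores the full vectorization,
  the Kronecker factor becomes a matrix product, and \<open>M_slvec\<close> extracts the strictly
  lower part again. Thus \<open>L\<close> is the operator sending (X, Y) to the strictly lower parts
  of TY - XT and RY - XR.\<close>

lemma L_mat_mult_slvec:
  assumes T: "T \<in> carrier_mat n n" and R: "R \<in> carrier_mat n n"
    and X: "X \<in> carrier_mat n n" "\<forall>j<n. \<forall>i\<le>j. X $$ (i, j) = 0"
    and Y: "Y \<in> carrier_mat n n" "\<forall>j<n. \<forall>i\<le>j. Y $$ (i, j) = 0"
  shows "L_mat n T R *\<^sub>v (slvec X @\<^sub>v slvec Y) =
    (- slvec (X * T) + slvec (T * Y)) @\<^sub>v (- slvec (X * R) + slvec (R * Y))"
proof -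
  let ?\<nu> = "n * (n - 1) div 2"
  let ?M = "M_slvec n :: complex mat"
  have M: "?M \<in> carrier_mat ?\<nu> (n * n)" by (rule M_slvec_carrier)
  \<comment> \<open>One statement with two-sided factors covers all four blocks: \<open>A\<close> is
    the identity in the \<open>X\<close> blocks, \<open>B\<close> in the \<open>Y\<close>
    blocks.\<close>
  have block: "?M * kronecker (transpose_mat B) A * transpose_mat ?M \<in> carrier_mat ?\<nu> ?\<nu>"
      "?M * kronecker (transpose_mat B) A * transpose_mat ?M *\<^sub>v slvec Z = slvec (A * Z * B)"
    if A: "A \<in> carrier_mat n n" and B: "B \<in> carrier_mat n n"
      and Z: "Z \<in> carrier_mat n n" "\<forall>j<n. \<forall>i\<le>j. Z $$ (i, j) = 0" for A B Z
  proof -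
    have K: "kronecker (transpose_mat B) A \<in> carrier_mat (n * n) (n * n)"
      using A B by (intro kronecker_carrier) auto
    show "?M * kronecker (transpose_mat B) A * transpose_mat ?M \<in> carrier_mat ?\<nu> ?\<nu>"
      using M K by auto
    have "?M * kronecker (transpose_mat B) A * transpose_mat ?M *\<^sub>v slvec Z
        = ?M * kronecker (transpose_mat B) A *\<^sub>v (transpose_mat ?M *\<^sub>v slvec Z)"
      using M K slvec_carrier[OF Z(1)] by (intro assoc_mult_mat_vec) auto
    also have "\<dots> = ?M *\<^sub>v (kronecker (transpose_mat B) A *\<^sub>v vectorize Z)"
      unfolding transpose_M_slvec_mult_slvec[OF Z]
      using M K vectorize_carrier[OF Z(1)] by (intro assoc_mult_mat_vec)
    also have "\<dots> = slvec (A * Z * B)"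
      using A B Z(1) by (simp add: kronecker_mult_vectorize slvec_eq_M_slvec[of _ n])
    finally show "?M * kronecker (transpose_mat B) A * transpose_mat ?M *\<^sub>v slvec Z
        = slvec (A * Z * B)" .
  qed
  note TX = block[OF one_carrier_mat T X] and RX = block[OF one_carrier_mat R X]
    and TY = block[OF T one_carrier_mat Y, unfolded transpose_one]
    and RY = block[OF R one_carrier_mat Y, unfolded transpose_one]
  have uminus: "- K *\<^sub>v slvec X = - (K *\<^sub>v slvec X)" if "K \<in> carrier_mat ?\<nu> ?\<nu>" for K
    using that slvec_carrier[OF X(1)] by (intro uminus_mult_mat_vec) auto
  have "L_mat n T R *\<^sub>v (slvec X @\<^sub>v slvec Y) =
    (- (?M * kronecker (transpose_mat T) (1\<^sub>m n) * transpose_mat ?M) *\<^sub>v slvec X +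
      ?M * kronecker (1\<^sub>m n) T * transpose_mat ?M *\<^sub>v slvec Y) @\<^sub>v
    (- (?M * kronecker (transpose_mat R) (1\<^sub>m n) * transpose_mat ?M) *\<^sub>v slvec X +
      ?M * kronecker (1\<^sub>m n) R * transpose_mat ?M *\<^sub>v slvec Y)"
    unfolding L_mat_def Let_def
    by (rule four_block_mat_mult_vec[of _ ?\<nu> ?\<nu> _ ?\<nu> _ ?\<nu>])
      (use TX(1) RX(1) TY(1) RY(1) X Y slvec_carrier in auto)
  thus ?thesis
    using T R X(1) Y(1)
    by (simp add: uminus[OF TX(1)] uminus[OF RX(1)] TX(2) TY(2) RX(2) RY(2)
        del: uminus_mult_left_mat)
qed

text \<open>Terms with \<open>k < i\<close> vanish because \<open>T\<close> is upper triangular,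
  those with \<open>k > i\<close> by \<open>below\<close>. Only column \<open>j\<close> of
  \<open>Y\<close> is constrained, which is what the induction over subdiagonals can supply.\<close>

lemma upper_lower_mult_index:
  fixes T Y :: "'a :: comm_ring_1 mat"
  assumes "T \<in> carrier_mat n n" "Y \<in> carrier_mat n n" "upper_triangular T" "i < n" "j < n"
    and below: "\<And>k. i < k \<Longrightarrow> k < n \<Longrightarrow> Y $$ (k, j) = 0"
  shows "(T * Y) $$ (i, j) = T $$ (i, i) * Y $$ (i, j)"
proof -
  have "(T * Y) $$ (i, j) = (\<Sum>k<n. T $$ (i, k) * Y $$ (k, j))"
    using assms by (simp add: scalar_prod_def atLeast0LessThan)
  also have "\<dots> = (\<Sum>k<n. if k = i then T $$ (i, i) * Y $$ (i, j) else 0)"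
  proof (intro sum.cong refl)
    fix k assume "k \<in> {..<n}"
    thus "T $$ (i, k) * Y $$ (k, j) = (if k = i then T $$ (i, i) * Y $$ (i, j) else 0)"
      using assms(1,4) below[of k] upper_triangularD[OF assms(3), of k i]
      by (cases k i rule: linorder_cases) auto
  qed
  finally show ?thesis using assms(4) by simp
qed

text \<open>Mirror image of the previous lemma: triangularity removes \<open>k > j\<close> and
  \<open>left\<close> removes \<open>k < j\<close>.\<close>

lemma lower_upper_mult_index:
  fixes T X :: "'a :: comm_ring_1 mat"
  assumes "T \<in> carrier_mat n n" "X \<in> carrier_mat n n" "upper_triangular T" "i < n" "j < n"
    and left: "\<And>k. k < j \<Longrightarrow> X $$ (i, k) = 0"
  shows "(X * T) $$ (i, j) = X $$ (i, j) * T $$ (j, j)"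
proof -
  have "(X * T) $$ (i, j) = (\<Sum>k<n. X $$ (i, k) * T $$ (k, j))"
    using assms by (simp add: scalar_prod_def atLeast0LessThan)
  also have "\<dots> = (\<Sum>k<n. if k = j then X $$ (i, j) * T $$ (j, j) else 0)"
  proof (intro sum.cong refl)
    fix k assume "k \<in> {..<n}"
    thus "X $$ (i, k) * T $$ (k, j) = (if k = j then X $$ (i, j) * T $$ (j, j) else 0)"
      using assms(1) left[of k] upper_triangularD[OF assms(3), of j k]
      by (cases k j rule: linorder_cases) auto
  qed
  finally show ?thesis using assms(5) by simp
qed

lemma generalized_sylvester_lower_zero:
  fixes T R X Y :: "'a :: field mat"
  assumes T: "T \<in> carrier_mat n n" "upper_triangular T"
    and R: "R \<in> carrier_mat n n" "upper_triangular R"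
    and X: "X \<in> carrier_mat n n" and Y: "Y \<in> carrier_mat n n"
    and distinct: "\<And>i j. j < i \<Longrightarrow> i < n \<Longrightarrow>
      T $$ (i, i) * R $$ (j, j) \<noteq> T $$ (j, j) * R $$ (i, i)"
    and eqT: "\<And>i j. j < i \<Longrightarrow> i < n \<Longrightarrow> (X * T) $$ (i, j) = (T * Y) $$ (i, j)"
    and eqR: "\<And>i j. j < i \<Longrightarrow> i < n \<Longrightarrow> (X * R) $$ (i, j) = (R * Y) $$ (i, j)"
    and "j < i" "i < n"
  shows "X $$ (i, j) = 0 \<and> Y $$ (i, j) = 0"
  using assms(10,11)
\<comment> \<open>The measure shrinks as \<open>i - j\<close> grows, so the corner entry comes
  first. Entries further down in column \<open>j\<close> or further left in row \<open>i\<close>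
  have larger \<open>i - j\<close> and are already known to vanish.\<close>
proof (induction "n - (i - j)" arbitrary: i j rule: less_induct)
  case less
  have j: "j < n" using less.prems by simp
  have Y0: "Y $$ (k, j) = 0" if "i < k" "k < n" for k
    using less.hyps[of k j] less.prems that by auto
  have X0: "X $$ (i, k) = 0" if "k < j" for k
    using less.hyps[of i k] less.prems that by auto
  let ?x = "X $$ (i, j)" and ?y = "Y $$ (i, j)"
  have t: "?x * T $$ (j, j) = T $$ (i, i) * ?y"
    using eqT[OF less.prems] lower_upper_mult_index[OF T(1) X T(2) less.prems(2) j X0]
      upper_lower_mult_index[OF T(1) Y T(2) less.prems(2) j Y0] by simp
  have r: "?x * R $$ (j, j) = R $$ (i, i) * ?y"
    using eqR[OF less.prems] lower_upper_mult_index[OF R(1) X R(2) less.prems(2) j X0]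
      upper_lower_mult_index[OF R(1) Y R(2) less.prems(2) j Y0] by simp
  \<comment> \<open>Cramer's rule for the homogeneous system \<open>t\<close>, \<open>r\<close>:
    eliminating \<open>?y\<close> leaves \<open>?x\<close> times the determinant. The next
    computation eliminates \<open>?x\<close> in the same way.\<close>
  have "?x * (T $$ (i, i) * R $$ (j, j) - T $$ (j, j) * R $$ (i, i))
      = T $$ (i, i) * (?x * R $$ (j, j)) - R $$ (i, i) * (?x * T $$ (j, j))"
    by (simp add: algebra_simps)
  also have "\<dots> = 0" unfolding t r by simp
  finally have x: "?x * (T $$ (i, i) * R $$ (j, j) - T $$ (j, j) * R $$ (i, i)) = 0" .
  have "?y * (T $$ (i, i) * R $$ (j, j) - T $$ (j, j) * R $$ (i, i))
      = (T $$ (i, i) * ?y) * R $$ (j, j) - T $$ (j, j) * (R $$ (i, i) * ?y)"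
    by (simp add: algebra_simps)
  also have "\<dots> = 0" unfolding t[symmetric] r[symmetric] by simp
  finally have y: "?y * (T $$ (i, i) * R $$ (j, j) - T $$ (j, j) * R $$ (i, i)) = 0" .
  show ?case using x y distinct[OF less.prems] by simp
qed

lemma invertible_mat_if_det_nonzero:
  fixes A :: "'a :: field mat"
  assumes A: "A \<in> carrier_mat n n" and "det A \<noteq> 0"
  shows "invertible_mat A"
proof -
  have "A \<in> Units (ring_mat TYPE('a) n ())"
    using assms by (rule det_non_zero_imp_unit)
  then obtain B where "B \<in> carrier_mat n n" "A * B = 1\<^sub>m n" "B * A = 1\<^sub>m n"
    by (auto simp: Units_def ring_mat_def)
  thus ?thesis using A by (auto simp: invertible_mat_def inverts_mat_def)
qed

text \<open>Proved through triviality of the kernel. The eigenvalue condition is cross-multiplied,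
  so that it also makes sense for infinite eigenvalues.\<close>

lemma invertible_L_mat:
  assumes T: "T \<in> carrier_mat n n" "upper_triangular T"
    and R: "R \<in> carrier_mat n n" "upper_triangular R"
    and distinct: "\<And>i j. j < i \<Longrightarrow> i < n \<Longrightarrow>
      T $$ (i, i) * R $$ (j, j) \<noteq> T $$ (j, j) * R $$ (i, i)"
  shows "invertible_mat (L_mat n T R)"
proof -
  let ?\<nu> = "n * (n - 1) div 2"
  note L = L_mat_carrier[OF T(1) R(1)]
  have "v = 0\<^sub>v (?\<nu> + ?\<nu>)"
    if v: "v \<in> carrier_vec (?\<nu> + ?\<nu>)" and Lv: "L_mat n T R *\<^sub>v v = 0\<^sub>v (?\<nu> + ?\<nu>)" for v
  proof -
    obtain X where X: "X \<in> carrier_mat n n" "\<forall>j<n. \<forall>i\<le>j. X $$ (i, j) = 0"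
      "slvec X = vec_first v ?\<nu>"
      using slvec_surj[OF vec_first_carrier] by metis
    obtain Y where Y: "Y \<in> carrier_mat n n" "\<forall>j<n. \<forall>i\<le>j. Y $$ (i, j) = 0"
      "slvec Y = vec_last v ?\<nu>"
      using slvec_surj[OF vec_last_carrier] by metis
    have v_eq: "v = slvec X @\<^sub>v slvec Y" using v X(3) Y(3) by simp
    have carr: "slvec (X * T) \<in> carrier_vec ?\<nu>" "slvec (T * Y) \<in> carrier_vec ?\<nu>"
      "slvec (X * R) \<in> carrier_vec ?\<nu>" "slvec (R * Y) \<in> carrier_vec ?\<nu>"
      by (rule slvec_carrier, use T(1) R(1) X(1) Y(1) in simp)+
    have zero_append: "0\<^sub>v a @\<^sub>v 0\<^sub>v b = (0\<^sub>v (a + b) :: complex vec)" for a b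
      by (intro eq_vecI) auto
    have "(- slvec (X * T) + slvec (T * Y)) @\<^sub>v (- slvec (X * R) + slvec (R * Y))
        = 0\<^sub>v ?\<nu> @\<^sub>v 0\<^sub>v ?\<nu>"
      using Lv unfolding v_eq L_mat_mult_slvec[OF T(1) R(1) X(1,2) Y(1,2)]
      by (simp only: zero_append)
    hence zero: "- slvec (X * T) + slvec (T * Y) = 0\<^sub>v ?\<nu>" "- slvec (X * R) + slvec (R * Y) = 0\<^sub>v ?\<nu>"
      using carr by (auto simp: append_vec_eq[of _ ?\<nu>])
    \<comment> \<open>Equality of the \<open>slvec\<close> images is translated back to the strictly
      lower entries through the explicit position formula.\<close>
    have entries: "P $$ (i, j) = Q $$ (i, j)"
      if "P \<in> carrier_mat n n" "Q \<in> carrier_mat n n" "- slvec P + slvec Q = 0\<^sub>v ?\<nu>"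
        "j < i" "i < n" for P Q :: "complex mat" and i j
    proof -
      let ?l = "i + j * n - (j + 1) * (j + 2) div 2"
      have l: "?l < ?\<nu>" by (rule sl_indices_nth(1)[OF that(4,5)])
      have "(- slvec P + slvec Q) $ ?l = 0" using l that(3) by simp
      thus ?thesis
        using l slvec_carrier[OF that(1)] slvec_carrier[OF that(2)]
          slvec_entry[OF that(1,4,5)] slvec_entry[OF that(2,4,5)] by simp
    qed
    have low: "X $$ (i, j) = 0 \<and> Y $$ (i, j) = 0" if "j < i" "i < n" for i j
      by (rule generalized_sylvester_lower_zero[OF T R X(1) Y(1) distinct _ _ that])
        (use entries[OF _ _ zero(1)] entries[OF _ _ zero(2)] T R X Y in auto)
    have "X = 0\<^sub>m n n" "Y = 0\<^sub>m n n"
      using X(1,2) Y(1,2) low by (auto intro!: eq_matI) (metis not_le_imp_less)+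
    thus ?thesis by (simp add: v_eq slvec_zero zero_append)
  qed
  hence "det (L_mat n T R) \<noteq> 0"
    using det_0_iff_vec_prod_zero_field[OF L] by blast
  thus ?thesis by (rule invertible_mat_if_det_nonzero[OF L])
qed

section \<open>Regularity and distinctness of the generalized eigenvalues\<close>

text \<open>If both diagonal entries were 0, the triangular matrix T - zR would be singular for
  every \<open>z\<close>, so the polynomial det(A - zB) would have every complex number as a root
  and be zero.\<close>

lemma regular_pair_diag:
  assumes S: "generalized_schur n A B U V T R" and reg: "regular_pair A B" and i: "i < n"
  shows "T $$ (i, i) \<noteq> 0 \<or> R $$ (i, i) \<noteq> 0"
proof (rule ccontr)
  assume zero: "\<not> ?thesis"
  have U: "U \<in> carrier_mat n n" and V: "V \<in> carrier_mat n n" and T: "T \<in> carrier_mat n n"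
    and R: "R \<in> carrier_mat n n" and tri: "upper_triangular T" "upper_triangular R"
    and A: "A = U * T * mat_adjoint V" and B: "B = U * R * mat_adjoint V"
    using S by (auto simp: generalized_schur_def)
  have V': "mat_adjoint V \<in> carrier_mat n n" using V by (auto simp: mat_adjoint_def)
  let ?D = "map_mat (\<lambda>a. [:a:]) A - [:0, 1:] \<cdot>\<^sub>m map_mat (\<lambda>b. [:b:]) B"
  have "poly (det ?D) z = 0" for z
  proof -
    \<comment> \<open>Evaluation at \<open>z\<close> is a ring homomorphism and hence commutes with
      the determinant; this passes from the polynomial pencil to complex matrices.\<close>
    have hom: "comm_ring_hom (\<lambda>p. poly p z)" by unfold_locales auto
    have D: "T - z \<cdot>\<^sub>m R \<in> carrier_mat n n" using T R by auto
    have eval: "map_mat (\<lambda>p. poly p z) ?D = A - z \<cdot>\<^sub>m B"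
      unfolding A B using U V' T R by (intro eq_matI) auto
    have factor: "A - z \<cdot>\<^sub>m B = U * (T - z \<cdot>\<^sub>m R) * mat_adjoint V"
      unfolding A B using U V' T R
      by (simp add: mult_minus_distrib_mat minus_mult_distrib_mat[of _ n n])
        (simp add: mult_smult_distrib[of _ n n] mult_smult_assoc_mat[of _ n n])
    have "(T - z \<cdot>\<^sub>m R) $$ (i, i) = 0" using T R i zero by simp
    hence "0 \<in> set (diag_mat (T - z \<cdot>\<^sub>m R))"
      using D i by (auto simp: diag_mat_def image_iff intro!: bexI[of _ i])
    moreover have "upper_triangular (T - z \<cdot>\<^sub>m R)"
      using T R upper_triangularD[OF tri(1)] upper_triangularD[OF tri(2)]
      by (intro upper_triangularI) simp
    ultimately have "det (T - z \<cdot>\<^sub>m R) = 0"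
      using det_upper_triangular[OF _ D] by (simp add: prod_list_zero_iff)
    hence "det (A - z \<cdot>\<^sub>m B) = 0"
      unfolding factor using U V' D by (simp add: det_mult[of _ n])
    thus ?thesis
      using comm_ring_hom.hom_det[OF hom, of ?D] unfolding eval by simp
  qed
  hence "det ?D = 0" using poly_all_0_iff_0 by blast
  thus False using reg by (simp add: regular_pair_def)
qed

text \<open>If both \<open>R\<close> entries are nonzero, equal cross products mean equal quotients;
  if both are 0, both eigenvalues are \<open>None\<close>. If exactly one is 0, the equation forces
  the \<open>T\<close> entry at the same index to be 0 too, contradicting regularity.\<close>

lemma gen_eigenvalues_distinct:
  assumes S: "generalized_schur n A B U V T R" and reg: "regular_pair A B"
    and inj: "inj_on (gen_eigenvalue T R) {..<n}" and ij: "i < n" "j < n" "i \<noteq> j"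
  shows "T $$ (i, i) * R $$ (j, j) \<noteq> T $$ (j, j) * R $$ (i, i)"
proof
  assume eq: "T $$ (i, i) * R $$ (j, j) = T $$ (j, j) * R $$ (i, i)"
  have "gen_eigenvalue T R i = gen_eigenvalue T R j"
    using eq regular_pair_diag[OF S reg ij(1)] regular_pair_diag[OF S reg ij(2)]
    by (auto simp: gen_eigenvalue_def frac_eq_eq)
  thus False using inj ij by (auto simp: inj_on_def)
qed

subsection \<open>Unitary invariance of the Frobenius norm\<close>

lemma mat_adjoint_carrier: "A \<in> carrier_mat m n \<Longrightarrow> mat_adjoint A \<in> carrier_mat n m"
  by (auto simp: mat_adjoint_def)

lemma mat_adjoint_index:
  "A \<in> carrier_mat m n \<Longrightarrow> i < n \<Longrightarrow> j < m \<Longrightarrow> mat_adjoint A $$ (i, j) = conjugate (A $$ (j, i))"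
  by (auto simp: mat_adjoint_def mat_of_rows_index)

lemma mat_adjoint_adjoint:
  fixes A :: "complex mat"
  assumes "A \<in> carrier_mat m n"
  shows "mat_adjoint (mat_adjoint A) = A"
  using assms mat_adjoint_carrier[OF assms] mat_adjoint_carrier[OF mat_adjoint_carrier[OF assms]]
  by (intro eq_matI) (auto simp: mat_adjoint_index)

lemma mat_adjoint_mult:
  fixes A B :: "complex mat"
  assumes A: "A \<in> carrier_mat m n" and B: "B \<in> carrier_mat n k"
  shows "mat_adjoint (A * B) = mat_adjoint B * mat_adjoint A"
proof -
  note AB = mult_carrier_mat[OF A B]
  note c = mat_adjoint_carrier[OF A] mat_adjoint_carrier[OF B] mat_adjoint_carrier[OF AB]
  show ?thesis
    by (rule eq_matI)
      (use A B AB c in \<open>auto simp: mat_adjoint_index[OF A] mat_adjoint_index[OF B]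
        mat_adjoint_index[OF AB] scalar_prod_def mult.commute intro!: sum.cong\<close>)
qed

lemma frobenius_norm_squared:
  assumes "A \<in> carrier_mat m n"
  shows "(frobenius_norm A)\<^sup>2 = (\<Sum>i<m. \<Sum>j<n. (cmod (A $$ (i, j)))\<^sup>2)"
  using assms by (simp add: frobenius_norm_def L2_set_def sum_nonneg sum.cartesian_product
      case_prod_unfold)

lemma frobenius_norm_nonneg: "0 \<le> frobenius_norm A"
  by (simp add: frobenius_norm_def)

lemma frobenius_norm_adjoint:
  assumes "A \<in> carrier_mat m n"
  shows "frobenius_norm (mat_adjoint A) = frobenius_norm A"
proof (rule power2_eq_imp_eq)
  have "(frobenius_norm (mat_adjoint A))\<^sup>2 = (\<Sum>j<n. \<Sum>i<m. (cmod (A $$ (i, j)))\<^sup>2)"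
    using frobenius_norm_squared[OF mat_adjoint_carrier[OF assms]]
    by (simp add: mat_adjoint_index[OF assms])
  also have "\<dots> = (frobenius_norm A)\<^sup>2"
    unfolding frobenius_norm_squared[OF assms] by (rule sum.swap)
  finally show "(frobenius_norm (mat_adjoint A))\<^sup>2 = (frobenius_norm A)\<^sup>2" .
qed (rule frobenius_norm_nonneg)+

text \<open>Writing the squared norm as the trace of A^H A reduces left unitary invariance to a
  cancellation of W^H W.\<close>

lemma frobenius_norm_trace:
  assumes "A \<in> carrier_mat m n"
  shows "of_real ((frobenius_norm A)\<^sup>2) = (\<Sum>j<n. (mat_adjoint A * A) $$ (j, j))"
proof -
  have "(mat_adjoint A * A) $$ (j, j) = (\<Sum>i<m. of_real ((cmod (A $$ (i, j)))\<^sup>2))" if "j < n" for j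
    using assms mat_adjoint_carrier[OF assms] that
    by (simp add: scalar_prod_def mat_adjoint_index[OF assms] atLeast0LessThan
        complex_norm_square mult.commute del: of_real_power)
  thus ?thesis
    unfolding frobenius_norm_squared[OF assms] by (subst sum.swap) simp
qed

lemma frobenius_norm_unitary_left:
  assumes W: "W \<in> carrier_mat m m" "unitary_mat W" and A: "A \<in> carrier_mat m n"
  shows "frobenius_norm (W * A) = frobenius_norm A"
proof -
  note W' = mat_adjoint_carrier[OF W(1)] and A' = mat_adjoint_carrier[OF A]
  have one: "mat_adjoint W * W = 1\<^sub>m m"
    using W W' by (auto simp: unitary_mat_def inverts_mat_def)
  have "mat_adjoint (W * A) * (W * A) = mat_adjoint A * (mat_adjoint W * (W * A))"
    unfolding mat_adjoint_mult[OF W(1) A] using W(1) W' A A' by (intro assoc_mult_mat) auto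
  also have "mat_adjoint W * (W * A) = mat_adjoint W * W * A"
    using W(1) W' A by (intro assoc_mult_mat[symmetric]) auto
  also have "\<dots> = A" using A by (simp add: one)
  finally have "(frobenius_norm (W * A))\<^sup>2 = (frobenius_norm A)\<^sup>2"
    using frobenius_norm_trace[OF mult_carrier_mat[OF W(1) A]] frobenius_norm_trace[OF A]
    by (metis of_real_eq_iff)
  thus ?thesis by (rule power2_eq_imp_eq) (rule frobenius_norm_nonneg)+
qed

lemma unitary_mat_adjoint:
  assumes "W \<in> carrier_mat m m" "unitary_mat W"
  shows "unitary_mat (mat_adjoint W)"
  using assms mat_adjoint_carrier[OF assms(1)]
  by (auto simp: unitary_mat_def mat_adjoint_adjoint[OF assms(1)])

text \<open>Taking adjoints preserves the norm and turns right multiplication into left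
  multiplication by the unitary matrix \<open>mat_adjoint W\<close>.\<close>

lemma frobenius_norm_unitary_right:
  assumes W: "W \<in> carrier_mat n n" "unitary_mat W" and A: "A \<in> carrier_mat m n"
  shows "frobenius_norm (A * W) = frobenius_norm A"
proof -
  have "frobenius_norm (A * W) = frobenius_norm (mat_adjoint (A * W))"
    by (rule frobenius_norm_adjoint[OF mult_carrier_mat[OF A W(1)], symmetric])
  also have "\<dots> = frobenius_norm (mat_adjoint A)"
    unfolding mat_adjoint_mult[OF A W(1)]
    by (rule frobenius_norm_unitary_left[OF mat_adjoint_carrier[OF W(1)]
        unitary_mat_adjoint[OF W] mat_adjoint_carrier[OF A]])
  finally show ?thesis by (simp add: frobenius_norm_adjoint[OF A])
qed

lemma frobenius_norm_uminus: "frobenius_norm (- A) = frobenius_norm A"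
  by (auto simp: frobenius_norm_def intro!: L2_set_cong)

lemma sum_lessThan_add:
  fixes h :: "nat \<Rightarrow> 'a :: comm_monoid_add"
  shows "(\<Sum>i<m + k. h i) = (\<Sum>i<m. h i) + (\<Sum>i<k. h (m + i))"
  by (induction k) (simp_all add: add.assoc)

lemma frobenius_norm_append_rows:
  assumes A: "A \<in> carrier_mat m n" and B: "B \<in> carrier_mat k n"
  shows "(frobenius_norm (A @\<^sub>r B))\<^sup>2 = (frobenius_norm A)\<^sup>2 + (frobenius_norm B)\<^sup>2"
proof -
  let ?h = "\<lambda>i. \<Sum>j<n. (cmod ((A @\<^sub>r B) $$ (i, j)))\<^sup>2"
  have "(\<Sum>i<m + k. ?h i) = (\<Sum>i<m. ?h i) + (\<Sum>i<k. ?h (m + i))"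
    by (rule sum_lessThan_add)
  thus ?thesis
    using A B unfolding frobenius_norm_squared[OF A] frobenius_norm_squared[OF B]
      frobenius_norm_squared[OF carrier_append_rows[OF A B]]
    by (simp add: append_rows_def)
qed

section \<open>The Euclidean norm, its comparison with the Frobenius norm, and
  Cauchy-Schwarz\<close>

lemma norm2_vec_squared: "(norm2_vec v)\<^sup>2 = (\<Sum>i<dim_vec v. (cmod (v $ i))\<^sup>2)"
  by (simp add: norm2_vec_def L2_set_def sum_nonneg)

lemma norm2_vec_nonneg: "0 \<le> norm2_vec v"
  by (simp add: norm2_vec_def)

lemma norm2_vec_append: "(norm2_vec (v @\<^sub>v w))\<^sup>2 = (norm2_vec v)\<^sup>2 + (norm2_vec w)\<^sup>2"
  by (simp add: norm2_vec_squared sum_lessThan_add)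

text \<open>The vector lists some of the matrix entries, each once, so its sum of squares is a
  partial sum of nonnegative terms.\<close>

lemma norm2_slvec_le:
  assumes A: "A \<in> carrier_mat n n"
  shows "norm2_vec (slvec A) \<le> frobenius_norm A"
proof (rule power2_le_imp_le[OF _ frobenius_norm_nonneg])
  have "(norm2_vec (slvec A))\<^sup>2
      = (\<Sum>l<n * (n - 1) div 2. (cmod (A $$ (sl_indices n ! l)))\<^sup>2)"
    using slvec_carrier[OF A] by (simp add: norm2_vec_squared slvec_index[OF A])
  also have "\<dots> = (\<Sum>p | snd p < fst p \<and> fst p < n. (cmod (A $$ p))\<^sup>2)"
    by (rule sum_sl_indices)
  also have "\<dots> \<le> (\<Sum>p\<in>{..<n} \<times> {..<n}. (cmod (A $$ p))\<^sup>2)"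
    by (rule sum_mono2) auto
  also have "\<dots> = (frobenius_norm A)\<^sup>2"
    using A by (simp add: frobenius_norm_def L2_set_def sum_nonneg)
  finally show "(norm2_vec (slvec A))\<^sup>2 \<le> (frobenius_norm A)\<^sup>2" .
qed

text \<open>Here \<open>\<bullet>\<close> is the bilinear product without conjugation. The triangle
  inequality passes to moduli, where the real Cauchy-Schwarz inequality applies.\<close>

lemma cmod_scalar_prod_le:
  assumes "v \<in> carrier_vec m" "w \<in> carrier_vec m"
  shows "cmod (v \<bullet> w) \<le> norm2_vec v * norm2_vec w"
proof -
  have "cmod (v \<bullet> w) \<le> (\<Sum>i<m. \<bar>cmod (v $ i)\<bar> * \<bar>cmod (w $ i)\<bar>)"
    using assms norm_sum[of "\<lambda>i. v $ i * w $ i" "{..<m}"]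
    by (simp add: scalar_prod_def atLeast0LessThan norm_mult)
  also have "\<dots> \<le> norm2_vec v * norm2_vec w"
    using L2_set_mult_ineq[of "\<lambda>i. cmod (v $ i)" "\<lambda>i. cmod (w $ i)" "{..<m}"] assms
    by (simp add: norm2_vec_def)
  finally show ?thesis .
qed

lemma norm2_slvec_transformed_le:
  assumes P: "P \<in> carrier_mat n n" "unitary_mat P" and Q: "Q \<in> carrier_mat n n" "unitary_mat Q"
    and A: "A \<in> carrier_mat n n"
  shows "norm2_vec (slvec (- (mat_adjoint P * A * Q))) \<le> frobenius_norm A"
proof -
  note P' = mat_adjoint_carrier[OF P(1)]
  have "norm2_vec (slvec (- (mat_adjoint P * A * Q))) \<le> frobenius_norm (- (mat_adjoint P * A * Q))"
    using P' Q A by (intro norm2_slvec_le) auto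
  also have "\<dots> = frobenius_norm A"
    using frobenius_norm_unitary_right[OF Q mult_carrier_mat[OF P' A]]
      frobenius_norm_unitary_left[OF P' unitary_mat_adjoint[OF P] A]
    by (simp add: frobenius_norm_uminus)
  finally show ?thesis .
qed

section \<open>Componentwise bounds for the linear approximations\<close>

theorem theorem1:
  fixes n \<nu> :: nat
    and A B \<Delta>A \<Delta>B U V T R U' V' T' R' L Linv :: "complex mat"
    and x y x_lin y_lin f g :: "complex vec"
  assumes "n \<ge> 2" and "\<nu> = n * (n - 1) div 2"
    and "A \<in> carrier_mat n n" and "B \<in> carrier_mat n n"
    and "\<Delta>A \<in> carrier_mat n n" and "\<Delta>B \<in> carrier_mat n n"
    and "regular_pair A B"
    and "generalized_schur n A B U V T R"
    and "inj_on (gen_eigenvalue T R) {..<n}"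
    and "generalized_schur n (A + \<Delta>A) (B + \<Delta>B) U' V' T' R'"
    and "x = slvec (mat_adjoint U * (U' - U))"
    and "y = slvec (mat_adjoint V * (V' - V))"
    and "f = slvec (- (mat_adjoint U' * \<Delta>A * V'))"
    and "g = slvec (- (mat_adjoint U' * \<Delta>B * V'))"
    and "L = L_mat n T R" and "Linv = the (mat_inverse L)"
    and "x_lin \<in> carrier_vec \<nu>" and "y_lin \<in> carrier_vec \<nu>"
    and "x_lin @\<^sub>v y_lin = Linv *\<^sub>v (f @\<^sub>v g)"
  shows "invertible_mat L \<and>
    (\<forall>j<\<nu>. cmod (x_lin $ j) \<le> norm2_vec (row Linv j) * frobenius_norm (\<Delta>A @\<^sub>r \<Delta>B) \<and>
            cmod (y_lin $ j) \<le> norm2_vec (row Linv (j + \<nu>)) * frobenius_norm (\<Delta>A @\<^sub>r \<Delta>B))"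
proof -
  have S: "generalized_schur n A B U V T R" by fact
  have T: "T \<in> carrier_mat n n" "upper_triangular T" and R: "R \<in> carrier_mat n n" "upper_triangular R"
    using S by (auto simp: generalized_schur_def)
  have U': "U' \<in> carrier_mat n n" "unitary_mat U'" and V': "V' \<in> carrier_mat n n" "unitary_mat V'"
    using \<open>generalized_schur n (A + \<Delta>A) (B + \<Delta>B) U' V' T' R'\<close>
    by (auto simp: generalized_schur_def)
  have L: "L \<in> carrier_mat (\<nu> + \<nu>) (\<nu> + \<nu>)"
    using L_mat_carrier[OF T(1) R(1)] assms(2,15) by simp
  have inv: "invertible_mat L"
    unfolding \<open>L = L_mat n T R\<close>
    by (intro invertible_L_mat[OF T R] gen_eigenvalues_distinct[OF S assms(7,9)]) auto
  \<comment> \<open>Invertibility ensures that \<open>mat_inverse L\<close> is not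
    \<open>None\<close>, so \<open>the\<close> returns a genuine inverse.\<close>
  have Linv: "Linv \<in> carrier_mat (\<nu> + \<nu>) (\<nu> + \<nu>)"
    unfolding \<open>Linv = the (mat_inverse L)\<close> by (rule mat_inverse_invertible(1)[OF L inv])
  note U'H = mat_adjoint_carrier[OF U'(1)]
  have f: "f \<in> carrier_vec \<nu>" and g: "g \<in> carrier_vec \<nu>"
    unfolding \<open>f = _\<close> \<open>g = _\<close> \<open>\<nu> = _\<close> by (rule slvec_carrier, use U'H V'(1) assms(5,6) in simp)+
  \<comment> \<open>Both norms are additive under stacking only after squaring, so the separate
    bounds for \<open>f\<close> and \<open>g\<close> are added in squared form.\<close>
  have "(norm2_vec (f @\<^sub>v g))\<^sup>2 \<le> (frobenius_norm (\<Delta>A @\<^sub>r \<Delta>B))\<^sup>2"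
    unfolding norm2_vec_append frobenius_norm_append_rows[OF assms(5,6)] \<open>f = _\<close> \<open>g = _\<close>
    using norm2_slvec_transformed_le[OF U' V'] assms(5,6)
    by (intro add_mono power_mono) (auto simp: norm2_vec_nonneg)
  hence fg: "norm2_vec (f @\<^sub>v g) \<le> frobenius_norm (\<Delta>A @\<^sub>r \<Delta>B)"
    by (rule power2_le_imp_le) (rule frobenius_norm_nonneg)
  \<comment> \<open>Treated for the stacked vector at once: \<open>l = j\<close> later gives the
    bound for \<open>x_lin\<close>, and \<open>l = j + \<nu>\<close> the one for
    \<open>y_lin\<close>.\<close>
  have bound: "cmod ((x_lin @\<^sub>v y_lin) $ l) \<le> norm2_vec (row Linv l) * frobenius_norm (\<Delta>A @\<^sub>r \<Delta>B)"
    if l: "l < \<nu> + \<nu>" for l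
  proof -
    have "cmod ((x_lin @\<^sub>v y_lin) $ l) = cmod (row Linv l \<bullet> (f @\<^sub>v g))"
      using assms(19) Linv l by simp
    also have "\<dots> \<le> norm2_vec (row Linv l) * norm2_vec (f @\<^sub>v g)"
      by (rule cmod_scalar_prod_le[of _ "\<nu> + \<nu>"]) (use Linv l f g in auto)
    also have "\<dots> \<le> norm2_vec (row Linv l) * frobenius_norm (\<Delta>A @\<^sub>r \<Delta>B)"
      by (rule mult_left_mono[OF fg norm2_vec_nonneg])
    finally show ?thesis .
  qed
  have "cmod (x_lin $ j) \<le> norm2_vec (row Linv j) * frobenius_norm (\<Delta>A @\<^sub>r \<Delta>B) \<and>
      cmod (y_lin $ j) \<le> norm2_vec (row Linv (j + \<nu>)) * frobenius_norm (\<Delta>A @\<^sub>r \<Delta>B)"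
    if "j < \<nu>" for j
    using bound[of j] bound[of "j + \<nu>"] that assms(17,18) by simp
  with inv show ?thesis by blast
qed

end
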